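(* In every anonymous hedonic game in which all agents have naturally single-peaked preferences (possibly with indifferences), every sequence of IS deviations starting from any initial partition is finite, and hence terminates in an individually stable partition.
   Context: In an anonymous hedonic game on agents $N=[n]$, each agent $i$ has a weak order $\succsim_i^S$ over sizes $\{1,\dots,n\}$, and compares coalitions containing $i$ by their sizes. Preferences are naturally single-peaked if for every agent $i$ and all integers $x,y,z\in[n]$ with $x>y>z$ or $z>y>x$ (usual order of integers), $x\succ_i^S y$ implies $y\succsim_i^S z$. An IS deviation of agent $i$ from partition $\pi$ to $\pi'$ is a move of $i$ alone from $\pi(i)$ into another coalition of $\pi$ or into a new singleton such that $\pi'(i)\succ_i\pi(i)$ and $\pi'(j)\succsim_j\pi(j)$ for every $j\in\pi'(i)\setminus\{i\}$. A partition is individually stable (IS) if no IS deviation is possible from it. *)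

theory Defs
  imports Main "HOL-Library.Disjoint_Sets"
begin

text \<open>Agents are N = {1..n}. Agent i's weak order over sizes is R i,
  where R i x y means that size x is weakly preferred to size y by agent i.\<close>

definition weak_order_on :: "nat set \<Rightarrow> (nat \<Rightarrow> nat \<Rightarrow> bool) \<Rightarrow> bool" where
  "weak_order_on A r \<longleftrightarrow>
     (\<forall>x\<in>A. \<forall>y\<in>A. r x y \<or> r y x) \<and>
     (\<forall>x\<in>A. \<forall>y\<in>A. \<forall>z\<in>A. r x y \<longrightarrow> r y z \<longrightarrow> r x z)"

definition strict_pref :: "(nat \<Rightarrow> nat \<Rightarrow> nat \<Rightarrow> bool) \<Rightarrow> nat \<Rightarrow> nat \<Rightarrow> nat \<Rightarrow> bool" where
  "strict_pref R i x y \<longleftrightarrow> R i x y \<and> \<not> R i y x"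

definition naturally_single_peaked :: "nat \<Rightarrow> (nat \<Rightarrow> nat \<Rightarrow> nat \<Rightarrow> bool) \<Rightarrow> bool" where
  "naturally_single_peaked n R \<longleftrightarrow>
     (\<forall>i\<in>{1..n}. \<forall>x\<in>{1..n}. \<forall>y\<in>{1..n}. \<forall>z\<in>{1..n}.
        ((x > y \<and> y > z) \<or> (z > y \<and> y > x)) \<longrightarrow> strict_pref R i x y \<longrightarrow> R i y z)"

definition coal :: "nat set set \<Rightarrow> nat \<Rightarrow> nat set" where
  "coal P i = (THE S. S \<in> P \<and> i \<in> S)"

text \<open>IS deviation of agent i from P into T, where T is another coalition of P
  or the empty set (meaning: i forms a new singleton).\<close>
definition IS_dev :: "nat \<Rightarrow> (nat \<Rightarrow> nat \<Rightarrow> nat \<Rightarrow> bool) \<Rightarrow> nat set set \<Rightarrow> nat set set \<Rightarrow> bool" where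
  "IS_dev n R P P' \<longleftrightarrow>
     (\<exists>i\<in>{1..n}. \<exists>T. (T \<in> P \<or> T = {}) \<and> T \<noteq> coal P i \<and>
        P' = ((P - {coal P i, T}) \<union> {coal P i - {i}, insert i T}) - {{}} \<and>
        strict_pref R i (card (insert i T)) (card (coal P i)) \<and>
        (\<forall>j\<in>T. R j (card (insert i T)) (card T)))"

definition IS_stable :: "nat \<Rightarrow> (nat \<Rightarrow> nat \<Rightarrow> nat \<Rightarrow> bool) \<Rightarrow> nat set set \<Rightarrow> bool" where
  "IS_stable n R P \<longleftrightarrow> partition_on {1..n} P \<and> \<not> (\<exists>P'. IS_dev n R P P')"

end

theory Submission
  imports Defs Complex_Main
begin

text \<open>The dynamics has a potential. Give each agent \<open>i\<close> a utility \<open>u i\<close> on sizes that represents the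
  strict preferences and whose increment from \<open>k\<close> to \<open>k + 1\<close> is at most \<open>1 / 2 ^ (k + 1)\<close>, with equality
  whenever \<open>i\<close> weakly prefers \<open>k + 1\<close> to \<open>k\<close>. The value of a coalition of size \<open>s\<close> is the sum of its
  members' utilities minus \<open>\<Sum>k=1..s. (k - 1) / 2 ^ k\<close>. When an agent leaves, the refunded
  last term of this sum covers the joint loss of the remaining members; when an agent joins with
  everybody's consent, the joint gain of the other members is exactly the new term. So the total
  value grows at least by the utility gain of the deviator.

  Single-peakedness is needed for the utilities to exist. They are built size by size, keeping a gap
  of \<open>1 / 2 ^ m\<close> between strictly ranked sizes up to \<open>m\<close>. A strict improvement from \<open>m\<close> to \<open>m + 1\<close> is
  possible only if \<open>m\<close> is already a best size so far, and otherwise the increment, half of the gap,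
  is too small to overtake a strictly better size.\<close>

section \<open>Utilities adapted to single-peaked preferences\<close>

definition adapted_utility :: "nat \<Rightarrow> (nat \<Rightarrow> nat \<Rightarrow> bool) \<Rightarrow> (nat \<Rightarrow> real) \<Rightarrow> bool" where
  "adapted_utility n r u \<longleftrightarrow>
     (\<forall>x\<in>{1..n}. \<forall>y\<in>{1..n}. \<not> r y x \<longrightarrow> u y < u x) \<and>
     (\<forall>k\<in>{1..<n}. u (Suc k) \<le> u k + 1 / 2 ^ Suc k \<and>
        (r (Suc k) k \<longrightarrow> u k + 1 / 2 ^ Suc k \<le> u (Suc k)))"

text \<open>An indifferent step still adds the full increment, so tied sizes may get different
  utilities, about which the gap says nothing. The last conjunct makes up for this in the induction:
  a newest size that is weakly best also has maximal utility.\<close>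

lemma adapted_utility_upto:
  fixes r :: "nat \<Rightarrow> nat \<Rightarrow> bool"
  assumes wo: "weak_order_on {1..n} r"
    and peak: "\<And>x y z. x \<in> {1..n} \<Longrightarrow> z \<in> {1..n} \<Longrightarrow> x < y \<Longrightarrow> y < z \<Longrightarrow> r y x \<or> r y z"
  shows "Suc m \<le> n \<Longrightarrow> \<exists>u :: nat \<Rightarrow> real.
      (\<forall>x\<in>{1..Suc m}. \<forall>y\<in>{1..Suc m}. \<not> r y x \<longrightarrow> u y + 1 / 2 ^ Suc m \<le> u x) \<and>
      (\<forall>k\<in>{1..m}. u (Suc k) \<le> u k + 1 / 2 ^ Suc k \<and>
         (r (Suc k) k \<longrightarrow> u k + 1 / 2 ^ Suc k \<le> u (Suc k))) \<and>
      ((\<forall>y\<in>{1..m}. r (Suc m) y) \<longrightarrow> (\<forall>y\<in>{1..m}. u y \<le> u (Suc m)))"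
proof (induction m)
  case 0
  then have "r 1 1" using wo[unfolded weak_order_on_def, THEN conjunct1] by fastforce
  then show ?case by simp
next
  case (Suc m)
  have tot: "r x y \<or> r y x" if "x \<in> {1..n}" "y \<in> {1..n}" for x y
    using wo[unfolded weak_order_on_def, THEN conjunct1] that by blast
  have trans: "r x z"
    if "r x y" "r y z" "x \<in> {1..n}" "y \<in> {1..n}" "z \<in> {1..n}" for x y z
    using wo[unfolded weak_order_on_def, THEN conjunct2] that by blast
  define a where "a = Suc m"
  define b where "b = Suc a"
  define d :: real where "d = 1 / 2 ^ b"
  have d: "0 < d" "1 / 2 ^ a = 2 * d" by (simp_all add: d_def b_def)
  have ab: "a \<in> {1..n}" "b \<in> {1..n}" "a < b" "1 \<le> a"
    using Suc.prems by (auto simp: a_def b_def)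
  have sub: "x \<in> {1..n}" if "x \<in> {1..a}" for x
    using that ab by auto
  obtain u :: "nat \<Rightarrow> real" where
    gap: "\<And>x y. x \<in> {1..a} \<Longrightarrow> y \<in> {1..a} \<Longrightarrow> \<not> r y x \<Longrightarrow> u y + 2 * d \<le> u x" and
    step: "\<And>k. k \<in> {1..m} \<Longrightarrow> u (Suc k) \<le> u k + 1 / 2 ^ Suc k \<and>
         (r (Suc k) k \<longrightarrow> u k + 1 / 2 ^ Suc k \<le> u (Suc k))" and
    top: "(\<forall>y\<in>{1..m}. r a y) \<Longrightarrow> (\<forall>y\<in>{1..m}. u y \<le> u a)"
    using Suc.IH[OF Suc_leD[OF Suc.prems]] unfolding a_def[symmetric] d(2) by blast
  have best: "u y \<le> u a" if "\<forall>y\<in>{1..m}. r a y" "y \<in> {1..a}" for y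
  proof (cases "y = a")
    case False
    then have "y \<in> {1..m}" using that(2) by (auto simp: a_def)
    then show ?thesis using top that(1) by blast
  qed simp
  obtain v where
    above: "\<And>x. x \<in> {1..a} \<Longrightarrow> \<not> r b x \<Longrightarrow> v + d \<le> u x" and
    below: "\<And>y. y \<in> {1..a} \<Longrightarrow> \<not> r y b \<Longrightarrow> u y + d \<le> v" and
    inc: "v \<le> u a + d" "r b a \<Longrightarrow> u a + d \<le> v" and
    vtop: "(\<forall>y\<in>{1..a}. r b y) \<Longrightarrow> (\<forall>y\<in>{1..a}. u y \<le> v)"
  proof (cases "r b a")
    case ba: True
    \<comment> \<open>Here \<open>inc\<close> forces the value: the full increment \<open>d\<close>,
      half of the old gap \<open>2 * d\<close>.\<close>
    show ?thesis
    proof (rule that[of "u a + d"])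
      fix x assume x: "x \<in> {1..a}" "\<not> r b x"
      have "\<not> r a x" using trans[OF ba] x sub ab by blast
      then show "u a + d + d \<le> u x" using gap[of x a] x ab by auto
    next
      fix y assume y: "y \<in> {1..a}" "\<not> r y b"
      show "u y + d \<le> u a + d"
      proof (cases "r a b")
        case True
        then have "\<not> r y a" using trans[of y a b] y sub ab by blast
        then show ?thesis using gap[of a y] y ab d by auto
      next
        case False
        \<comment> \<open>As \<open>z < a < b\<close>, size \<open>a\<close> is weakly as good as
          \<open>z\<close> or \<open>b\<close>. The latter is excluded, so \<open>a\<close> is a
          best size so far and has maximal utility.\<close>
        have "\<forall>z\<in>{1..m}. r a z" using peak[of _ b a] False sub ab by (force simp: a_def)
        then show ?thesis using best y by auto
      qed
    next
      assume b: "\<forall>y\<in>{1..a}. r b y"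
      \<comment> \<open>Either \<open>a\<close> is weakly as good as \<open>y\<close> directly, or
        it is so via \<open>b\<close>.\<close>
      have "\<forall>y\<in>{1..m}. r a y"
      proof
        fix y assume y: "y \<in> {1..m}"
        then have y': "y \<in> {1..a}" "y < a" by (auto simp: a_def)
        show "r a y"
          using peak[of y b a] trans[of a b y] y' b sub ab by blast
      qed
      then show "\<forall>y\<in>{1..a}. u y \<le> u a + d" using best d by fastforce
    qed auto
  next
    case ba: False
    \<comment> \<open>These are the sizes strictly better than \<open>b\<close>. A value
      \<open>d\<close> below their least utility leaves another \<open>d\<close> down to every size
      strictly worse than \<open>b\<close>, and \<open>a \<in> Z\<close> keeps the increment below
      its bound.\<close>
    define Z where "Z = {z \<in> {1..a}. \<not> r b z}"
    have Z: "finite (u ` Z)" "a \<in> Z" using ba ab by (auto simp: Z_def)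
    have Min_le: "Min (u ` Z) \<le> u z" if "z \<in> Z" for z using Z that by simp
    have "Min (u ` Z) \<in> u ` Z" using Z by (intro Min_in) auto
    then obtain w where w: "w \<in> {1..a}" "\<not> r b w" "Min (u ` Z) = u w"
      by (auto simp: Z_def)
    show ?thesis
    proof (rule that[of "Min (u ` Z) - d"])
      fix x assume "x \<in> {1..a}" "\<not> r b x"
      then show "Min (u ` Z) - d + d \<le> u x" using Min_le[of x] by (auto simp: Z_def)
    next
      fix y assume y: "y \<in> {1..a}" "\<not> r y b"
      have "r b y" using tot y(2) sub[OF y(1)] ab by blast
      then have "\<not> r y w" using trans[of b y w] w y sub ab by blast
      then have "u y + 2 * d \<le> u w" using gap w y by blast
      then show "u y + d \<le> Min (u ` Z) - d" using w by simp
    qed (use Min_le[OF Z(2)] d ba ab in auto)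
  qed
  have b_self: "r b b" using tot ab by blast
  have ivl: "{1..b} = insert b {1..a}" by (auto simp: b_def)
  let ?u = "u(b := v)"
  have u_old: "?u x = u x" if "x \<in> {1..a}" for x using that ab by auto
  have gap': "?u y + d \<le> ?u x" if "x \<in> {1..b}" "y \<in> {1..b}" "\<not> r y x" for x y
    using that gap[of x y] above[of x] below[of y] b_self d u_old[of x] u_old[of y]
    unfolding ivl by auto
  have step': "?u (Suc k) \<le> ?u k + 1 / 2 ^ Suc k \<and>
      (r (Suc k) k \<longrightarrow> ?u k + 1 / 2 ^ Suc k \<le> ?u (Suc k))" if "k \<in> {1..a}" for k
  proof (cases "k = a")
    case True
    then show ?thesis using inc ab by (simp add: b_def[symmetric] d_def[symmetric] del: power_Suc)
  next
    case False
    then have "k \<in> {1..m}" "k \<noteq> b" "Suc k \<noteq> b" using that by (auto simp: a_def b_def)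
    then show ?thesis using step[of k] by simp
  qed
  have top': "\<forall>y\<in>{1..a}. ?u y \<le> ?u b" if "\<forall>y\<in>{1..a}. r b y"
    using vtop[OF that] u_old by auto
  show ?case
    unfolding a_def[symmetric] b_def[symmetric] d_def[symmetric]
    using gap' step' top' by (intro exI[of _ ?u]) blast
qed

lemma adapted_utility_exists:
  assumes wo: "weak_order_on {1..n} (R i)" and "naturally_single_peaked n R" and i: "i \<in> {1..n}"
  obtains u where "adapted_utility n (R i) u"
proof -
  \<comment> \<open>Single-peakedness with totality: a middle size cannot be strictly worse than
    both outer ones.\<close>
  have peak: "R i y x \<or> R i y z"
    if x: "x \<in> {1..n}" and z: "z \<in> {1..n}" and l: "x < y" "y < z" for x y z
  proof (rule ccontr)
    assume neg: "\<not> (R i y x \<or> R i y z)"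
    have y: "y \<in> {1..n}" using x z l by auto
    then have "R i x y" using wo[unfolded weak_order_on_def, THEN conjunct1] x neg by blast
    then have "strict_pref R i x y" using neg by (simp add: strict_pref_def)
    then show False
      using assms(2) i x y z l neg unfolding naturally_single_peaked_def by blast
  qed
  obtain m where m: "n = Suc m" using i by (cases n) auto
  obtain u :: "nat \<Rightarrow> real" where
    "\<forall>x\<in>{1..n}. \<forall>y\<in>{1..n}. \<not> R i y x \<longrightarrow> u y + 1 / 2 ^ n \<le> u x"
    "\<forall>k\<in>{1..m}. u (Suc k) \<le> u k + 1 / 2 ^ Suc k \<and>
         (R i (Suc k) k \<longrightarrow> u k + 1 / 2 ^ Suc k \<le> u (Suc k))"
    using adapted_utility_upto[OF wo peak, of m] m by auto
  moreover have "u y < u x" if "u y + 1 / 2 ^ n \<le> u x" for x y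
    using that zero_less_divide_1_iff[of "2 ^ n :: real"] zero_less_power[of "2::real" n] by linarith
  ultimately have "adapted_utility n (R i) u"
    unfolding adapted_utility_def m atLeastLessThanSuc_atLeastAtMost by blast
  then show ?thesis by (rule that)
qed

section \<open>Coalition values when one agent joins or leaves\<close>

definition coalition_value :: "(nat \<Rightarrow> nat \<Rightarrow> real) \<Rightarrow> nat set \<Rightarrow> real" where
  "coalition_value U C = (\<Sum>i\<in>C. U i (card C)) - (\<Sum>k=1..card C. (real k - 1) / 2 ^ k)"

lemma coalition_value_empty [simp]: "coalition_value U {} = 0"
  by (simp add: coalition_value_def)

text \<open>The new penalty term is \<open>card T\<close> times \<open>1 / 2 ^ Suc (card T)\<close>,
  so it splits into one maximal increment charged to each old member.\<close>

lemma coalition_value_insert: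
  assumes "finite T" "i \<notin> T"
  shows "coalition_value U (insert i T) = coalition_value U T + U i (Suc (card T)) +
    (\<Sum>j\<in>T. U j (Suc (card T)) - U j (card T) - 1 / 2 ^ Suc (card T))"
  using assms by (simp add: coalition_value_def sum_subtractf)

text \<open>Read backwards, this bounds the loss when \<open>i\<close> leaves: no remaining member's
  increment exceeds its charge.\<close>

lemma coalition_value_insert_le:
  assumes ad: "\<And>j. j \<in> {1..n} \<Longrightarrow> adapted_utility n (R j) (U j)"
    and T: "insert i T \<subseteq> {1..n}" "i \<notin> T"
  shows "coalition_value U (insert i T) \<le> coalition_value U T + U i (Suc (card T))"
proof -
  have fin: "finite T" using T(1) finite_subset[of T "{1..n}"] by simp
  have "Suc (card T) \<le> n" using card_mono[OF _ T(1)] T fin by simp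
  \<comment> \<open>The member \<open>j\<close> excludes size 0, and the newcomer outside
    \<open>T\<close> excludes size \<open>n\<close>.\<close>
  then have range: "card T \<in> {1..<n}" if "j \<in> T" for j
    using that fin card_gt_0_iff[of T] by auto
  have "U j (Suc (card T)) - U j (card T) - 1 / 2 ^ Suc (card T) \<le> 0" if "j \<in> T" for j
  proof -
    have "adapted_utility n (R j) (U j)" using ad T that by blast
    then have "U j (Suc (card T)) \<le> U j (card T) + 1 / 2 ^ Suc (card T)"
      using range[OF that] unfolding adapted_utility_def by blast
    then show ?thesis by linarith
  qed
  then have "(\<Sum>j\<in>T. U j (Suc (card T)) - U j (card T) - 1 / 2 ^ Suc (card T)) \<le> 0"
    by (rule sum_nonpos)
  then show ?thesis using coalition_value_insert[OF fin T(2), of U] by linarith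
qed

text \<open>Consent makes each old member's increment cover its charge.\<close>

lemma coalition_value_insert_ge:
  assumes ad: "\<And>j. j \<in> {1..n} \<Longrightarrow> adapted_utility n (R j) (U j)"
    and T: "insert i T \<subseteq> {1..n}" "i \<notin> T"
    and accept: "\<And>j. j \<in> T \<Longrightarrow> R j (Suc (card T)) (card T)"
  shows "coalition_value U T + U i (Suc (card T)) \<le> coalition_value U (insert i T)"
proof -
  have fin: "finite T" using T(1) finite_subset[of T "{1..n}"] by simp
  have "Suc (card T) \<le> n" using card_mono[OF _ T(1)] T fin by simp
  then have range: "card T \<in> {1..<n}" if "j \<in> T" for j
    using that fin card_gt_0_iff[of T] by auto
  have "0 \<le> U j (Suc (card T)) - U j (card T) - 1 / 2 ^ Suc (card T)" if "j \<in> T" for j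
  proof -
    have "adapted_utility n (R j) (U j)" using ad T that by blast
    then have "U j (card T) + 1 / 2 ^ Suc (card T) \<le> U j (Suc (card T))"
      using range[OF that] accept[OF that] unfolding adapted_utility_def by blast
    then show ?thesis by linarith
  qed
  then have "0 \<le> (\<Sum>j\<in>T. U j (Suc (card T)) - U j (card T) - 1 / 2 ^ Suc (card T))"
    by (rule sum_nonneg)
  then show ?thesis using coalition_value_insert[OF fin T(2), of U] by linarith
qed

section \<open>Partitions under the move of one agent\<close>

lemma coal_eq:
  assumes "partition_on A P" "S \<in> P" "i \<in> S"
  shows "coal P i = S"
  unfolding coal_def
proof (rule the_equality)
  show "S' = S" if "S' \<in> P \<and> i \<in> S'" for S'
    using that assms disjointD[OF partition_onD2[OF assms(1)], of S' S] by blast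
qed (use assms in blast)

text \<open>The two new blocks are disjoint and split \<open>S \<union> T\<close> anew, away from
  all other blocks. Discarding \<open>{}\<close> handles a deviator who was alone.\<close>

lemma partition_on_move:
  assumes P: "partition_on A P" and S: "S \<in> P" "i \<in> S" and T: "T \<in> P \<or> T = {}" "T \<noteq> S"
  shows "partition_on A (((P - {S, T}) \<union> {S - {i}, insert i T}) - {{}})"
proof (rule partition_onI)
  have dis: "X \<inter> Y = {}" if "X \<in> P" "Y \<in> P" "X \<noteq> Y" for X Y
    using disjointD[OF partition_onD2[OF P]] that by blast
  have ST: "S \<inter> T = {}" using dis[of S T] S T by blast
  have "\<Union> (((P - {S, T}) \<union> {S - {i}, insert i T}) - {{}}) =
      \<Union> (P - {S, T}) \<union> ((S - {i}) \<union> insert i T)" by auto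
  also have "(S - {i}) \<union> insert i T = S \<union> T" using S by blast
  also have "\<Union> (P - {S, T}) \<union> (S \<union> T) = \<Union> P" using S(1) T(1) by auto
  finally show "\<Union> (((P - {S, T}) \<union> {S - {i}, insert i T}) - {{}}) = A"
    unfolding partition_onD1[OF P] .
  show "disjnt X Y"
    if XY: "X \<in> ((P - {S, T}) \<union> {S - {i}, insert i T}) - {{}}"
      "Y \<in> ((P - {S, T}) \<union> {S - {i}, insert i T}) - {{}}" "X \<noteq> Y" for X Y
  proof -
    have dis_ST: "Z \<inter> S = {}" "Z \<inter> T = {}" if "Z \<in> P - {S, T}" for Z
      using that dis[of Z S] dis[of Z T] S T by blast+
    have new: "S - {i} \<subseteq> S \<union> T" "insert i T \<subseteq> S \<union> T" using S by auto
    consider "X \<in> P - {S, T}" "Y \<in> P - {S, T}"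
      | "X \<in> P - {S, T}" "Y \<subseteq> S \<union> T" | "Y \<in> P - {S, T}" "X \<subseteq> S \<union> T"
      | "X = S - {i}" "Y = insert i T" | "X = insert i T" "Y = S - {i}"
      using XY new by (elim DiffE UnE insertE emptyE) simp_all
    then show ?thesis
    proof cases
      case 1
      then show ?thesis using dis[of X Y] XY(3) by (simp add: disjnt_def)
    next
      case 2
      then show ?thesis using dis_ST[of X] unfolding disjnt_def by blast
    next
      case 3
      then show ?thesis using dis_ST[of Y] unfolding disjnt_def by blast
    qed (use ST in \<open>auto simp: disjnt_def\<close>)
  qed
qed auto

text \<open>Since \<open>g {} = 0\<close>, an empty \<open>T\<close> or an emptied
  \<open>S - {i}\<close> can be counted as a block, which makes one formula fit all kinds of
  moves.\<close>

lemma sum_move: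
  fixes g :: "'a set \<Rightarrow> real"
  assumes P: "partition_on A P" "finite P" and S: "S \<in> P" "i \<in> S"
    and T: "T \<in> P \<or> T = {}" "T \<noteq> S" and g: "g {} = 0"
  shows "sum g (((P - {S, T}) \<union> {S - {i}, insert i T}) - {{}}) + g S + g T =
         sum g P + g (S - {i}) + g (insert i T)"
proof -
  let ?Q = "P - {S, T}"
  have dis: "X \<inter> Y = {}" if "X \<in> P" "Y \<in> P" "X \<noteq> Y" for X Y
    using disjointD[OF partition_onD2[OF P(1)]] that by blast
  have ne: "{} \<notin> P" using P(1) by (simp add: partition_on_def)
  \<comment> \<open>\<open>S\<close> is the only block of \<open>P\<close> containing
    \<open>i\<close>, and it is removed from \<open>?Q\<close>.\<close>
  have notin: "insert i T \<notin> ?Q" using dis[of "insert i T" S] S by blast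
  have notin': "S - {i} \<notin> ?Q"
  proof
    assume Q: "S - {i} \<in> ?Q"
    then have "S - {i} = {}" using dis[of "S - {i}" S] S by blast
    moreover have "S - {i} \<in> P" using Q by (rule DiffD1)
    ultimately show False using ne by (simp only:)
  qed
  have "sum g (?Q \<union> {S - {i}, insert i T} - {{}}) = sum g (?Q \<union> {S - {i}, insert i T})"
    by (rule sum.mono_neutral_left) (use P(2) g in auto)
  also have "?Q \<union> {S - {i}, insert i T} = insert (S - {i}) (insert (insert i T) ?Q)" by auto
  also have "sum g \<dots> = g (S - {i}) + sum g (insert (insert i T) ?Q)"
  proof (rule sum.insert)
    show "S - {i} \<notin> insert (insert i T) ?Q" using notin' by auto
  qed (use P in auto)
  also have "sum g (insert (insert i T) ?Q) = g (insert i T) + sum g ?Q"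
    using P(2) notin by simp
  finally have new: "sum g (?Q \<union> {S - {i}, insert i T} - {{}}) =
      g (S - {i}) + g (insert i T) + sum g ?Q" by simp
  have "sum g P = sum g (insert T P)"
  proof (cases "T \<in> P")
    case False
    then show ?thesis using P(2) T(1) g by simp
  qed (simp add: insert_absorb)
  also have "insert T P = insert S (insert T ?Q)" using S by auto
  also have "sum g \<dots> = g S + g T + sum g ?Q" using P(2) T(2) by simp
  finally show ?thesis using new by simp
qed

section \<open>The potential and termination\<close>

lemma IS_dev_increases_potential:
  assumes ad: "\<And>j. j \<in> {1..n} \<Longrightarrow> adapted_utility n (R j) (U j)"
    and P: "partition_on {1..n} P" and dev: "IS_dev n R P P'"
  shows "partition_on {1..n} P'"
    and "sum (coalition_value U) P < sum (coalition_value U) P'"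
proof -
  obtain i T where i: "i \<in> {1..n}" and T: "T \<in> P \<or> T = {}" "T \<noteq> coal P i" and
    P': "P' = ((P - {coal P i, T}) \<union> {coal P i - {i}, insert i T}) - {{}}" and
    better: "strict_pref R i (card (insert i T)) (card (coal P i))" and
    accept: "\<forall>j\<in>T. R j (card (insert i T)) (card T)"
    using dev unfolding IS_dev_def by blast
  obtain S where S: "S \<in> P" "i \<in> S" using i unfolding partition_onD1[OF P] by blast
  have coal: "coal P i = S" using coal_eq[OF P S] .
  note T = T[unfolded coal] and P' = P'[unfolded coal] and better = better[unfolded coal]
  show "partition_on {1..n} P'" unfolding P' by (rule partition_on_move[OF P S T])
  have finP: "finite P" using finite_elements[OF _ P] by simp
  have sub: "S \<subseteq> {1..n}" "T \<subseteq> {1..n}"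
    using partition_onD1[OF P] S T by auto
  have fin: "finite S" "finite T" using sub finite_subset[of _ "{1..n}"] by auto
  have iT: "i \<notin> T" using disjointD[OF partition_onD2[OF P], of S T] S T by blast
  have cT: "card (insert i T) = Suc (card T)" using fin iT by simp
  have cS: "Suc (card (S - {i})) = card S" using card_Suc_Diff1[OF fin(1) S(2)] .
  have insT: "insert i T \<subseteq> {1..n}" using i sub by simp
  have range: "card S \<in> {1..n}" "Suc (card T) \<in> {1..n}"
    using card_mono[OF _ sub(1)] card_mono[OF _ insT] cS cT by auto
  \<comment> \<open>The old coalition loses at most the left side and the new one gains at least the
    right side, so the total strictly grows.\<close>
  have "U i (card S) < U i (Suc (card T))"
    using ad[OF i, unfolded adapted_utility_def, THEN conjunct1] better range
    unfolding cT strict_pref_def by blast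
  moreover have "coalition_value U S \<le> coalition_value U (S - {i}) + U i (card S)"
    using coalition_value_insert_le[of n R U i "S - {i}", OF ad] S sub cS
    by (simp add: insert_absorb)
  moreover have "coalition_value U T + U i (Suc (card T)) \<le> coalition_value U (insert i T)"
    using coalition_value_insert_ge[of n R U i T, OF ad insT iT] accept cT by simp
  ultimately show "sum (coalition_value U) P < sum (coalition_value U) P'"
    using sum_move[OF P finP S T, of "coalition_value U"] unfolding P' by simp
qed

theorem theorem3p4:
  fixes n :: nat and R :: "nat \<Rightarrow> nat \<Rightarrow> nat \<Rightarrow> bool"
  assumes "\<forall>i\<in>{1..n}. weak_order_on {1..n} (R i)"
    and "naturally_single_peaked n R"
  shows "\<not> (\<exists>f :: nat \<Rightarrow> nat set set. partition_on {1..n} (f 0) \<and>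
              (\<forall>k. IS_dev n R (f k) (f (Suc k)))) \<and>
         (\<forall>P. partition_on {1..n} P \<longrightarrow>
           (\<exists>P'. (IS_dev n R)\<^sup>*\<^sup>* P P' \<and> IS_stable n R P'))"
proof -
  have "\<forall>i\<in>{1..n}. \<exists>u. adapted_utility n (R i) u"
  proof
    fix i assume "i \<in> {1..n}"
    then show "\<exists>u. adapted_utility n (R i) u"
      using adapted_utility_exists[of n R i] assms by blast
  qed
  then obtain U where "\<forall>i\<in>{1..n}. adapted_utility n (R i) (U i)"
    unfolding bchoice_iff by blast
  then have ad: "\<And>i. i \<in> {1..n} \<Longrightarrow> adapted_utility n (R i) (U i)" by blast
  note dev = IS_dev_increases_potential[of n R U, OF ad]
  \<comment> \<open>Deviations are reversed so that well-foundedness of \<open>D\<close> excludes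
    infinite sequences. The restriction to partitions makes \<open>D\<close> finite; a growing real
    potential then gives acyclicity, and both together give termination.\<close>
  define D where "D = {(P', P). partition_on {1..n} P \<and> IS_dev n R P P'}"
  have "D \<subseteq> Pow (Pow {1..n}) \<times> Pow (Pow {1..n})"
  proof -
    have "P \<in> Pow (Pow {1..n})" if "partition_on {1..n} P" for P
      using partition_onD1[OF that] by blast
    then show ?thesis using dev(1) unfolding D_def by blast
  qed
  then have "finite D" by (rule finite_subset) simp
  moreover have "acyclic D"
  proof -
    have "sum (coalition_value U) P < sum (coalition_value U) P'" if "(P', P) \<in> D\<^sup>+" for P P'
      using that
    proof induction
      case (base P)
      then show ?case using dev(2) by (simp add: D_def)
    next
      case (step P Q)
      then show ?case using dev(2)[of Q P] by (simp add: D_def)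
    qed
    then show ?thesis unfolding acyclic_def by blast
  qed
  ultimately have wf: "wf D" by (rule finite_acyclic_wf)
  have no_seq: "False" if f: "partition_on {1..n} (f 0)" "\<forall>k. IS_dev n R (f k) (f (Suc k))" for f
  proof -
    have "partition_on {1..n} (f k)" for k
      using f dev(1) by (induction k) blast+
    then have "\<forall>k. (f (Suc k), f k) \<in> D" using f unfolding D_def by blast
    then show False using wf unfolding wf_iff_no_infinite_down_chain by blast
  qed
  moreover have "partition_on {1..n} P \<longrightarrow> (\<exists>P'. (IS_dev n R)\<^sup>*\<^sup>* P P' \<and> IS_stable n R P')" for P
    using wf
  proof (induction P rule: wf_induct_rule)
    case (less P)
    show ?case
    proof (cases "\<exists>P'. IS_dev n R P P'")
      case True
      then obtain Q where Q: "IS_dev n R P Q" ..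
      show ?thesis
      proof
        assume P: "partition_on {1..n} P"
        then obtain P' where "(IS_dev n R)\<^sup>*\<^sup>* Q P'" "IS_stable n R P'"
          using less[of Q] dev(1)[OF _ P Q] Q unfolding D_def by blast
        then show "\<exists>P'. (IS_dev n R)\<^sup>*\<^sup>* P P' \<and> IS_stable n R P'"
          using converse_rtranclp_into_rtranclp[of "IS_dev n R", OF Q] by blast
      qed
    next
      case False
      then show ?thesis unfolding IS_stable_def by blast
    qed
  qed
  ultimately show ?thesis by blast
qed

end
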